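(* Fix any $0 < \epsilon \leq 1$ and let $\beta$ and $\beta^-$ be integers with $\beta \geq 50/\epsilon$ and $\beta^- \geq (1-\frac{\epsilon}{10})\beta$. Then for any (finite, undirected) graph $G$ and any $(\beta, \beta^-)$-EDCS $H$ of $G$, it holds that $\mu(H) \geq \big(\frac{2}{3} - \epsilon\big) \cdot \mu(G)$.
   Context: For a graph $K$, $\mu(K)$ denotes the size of a maximum matching of $K$, $\deg_K(v)$ is the degree of vertex $v$ in $K$. Let $G=(V,E)$ be a graph and let $\beta > \beta^- \geq 1$ be integers. A subgraph $H=(V,E_H)$ of $G$ (on the same vertex set) is a $(\beta,\beta^-)$-EDCS of $G$ if: (P1) for every edge $(u,v) \in E_H$, $\deg_H(u)+\deg_H(v) \leq \beta$; and (P2) for every edge $(u,v) \in E \setminus E_H$, $\deg_H(u)+\deg_H(v) \geq \beta^-$. *)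

theory Defs
  imports Complex_Main
begin

text \<open>A graph is a pair of a vertex set and a set of edges, an edge being an unordered pair.\<close>

type_synonym 'a ugraph = "'a set \<times> 'a set set"

definition verts :: "'a ugraph \<Rightarrow> 'a set" where
  "verts K = fst K"

definition edges :: "'a ugraph \<Rightarrow> 'a set set" where
  "edges K = snd K"

definition finite_graph :: "'a ugraph \<Rightarrow> bool" where
  "finite_graph K \<longleftrightarrow> finite (verts K) \<and> (\<forall>e\<in>edges K. e \<subseteq> verts K \<and> card e = 2)"

definition deg :: "'a ugraph \<Rightarrow> 'a \<Rightarrow> nat" where
  "deg K v = card {e \<in> edges K. v \<in> e}"

definition matching :: "'a ugraph \<Rightarrow> 'a set set \<Rightarrow> bool" where
  "matching K M \<longleftrightarrow> M \<subseteq> edges K \<and> (\<forall>e\<in>M. \<forall>f\<in>M. e \<noteq> f \<longrightarrow> e \<inter> f = {})"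

definition mu :: "'a ugraph \<Rightarrow> nat" where
  "mu K = Max (card ` {M. matching K M})"

definition spanning_subgraph :: "'a ugraph \<Rightarrow> 'a ugraph \<Rightarrow> bool" where
  "spanning_subgraph H G \<longleftrightarrow> verts H = verts G \<and> edges H \<subseteq> edges G"

definition EDCS :: "int \<Rightarrow> int \<Rightarrow> 'a ugraph \<Rightarrow> 'a ugraph \<Rightarrow> bool" where
  "EDCS \<beta> \<beta>m G H \<longleftrightarrow>
     spanning_subgraph H G \<and>
     (\<forall>u v. {u, v} \<in> edges H \<longrightarrow> int (deg H u) + int (deg H v) \<le> \<beta>) \<and>
     (\<forall>u v. {u, v} \<in> edges G - edges H \<longrightarrow> int (deg H u) + int (deg H v) \<ge> \<beta>m)"

text \<open>The maximum in the definition of \<open>mu\<close> ranges over a finite nonempty set.\<close>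

lemma finite_edges: "finite_graph K \<Longrightarrow> finite (edges K)"
  unfolding finite_graph_def by (rule finite_subset[of _ "Pow (verts K)"]) auto

lemma finite_matchings: "finite_graph K \<Longrightarrow> finite {M. matching K M}"
  by (rule finite_subset[of _ "Pow (edges K)"]) (auto simp: matching_def finite_edges)

lemma matching_empty: "matching K {}"
  by (simp add: matching_def)

lemma finite_graph_spanning_subgraph:
  "finite_graph G \<Longrightarrow> spanning_subgraph H G \<Longrightarrow> finite_graph H"
  by (auto simp: finite_graph_def spanning_subgraph_def)

end

theory Submission
  imports Defs "HOL-Library.Disjoint_Sets"
begin

text \<open>By Tutte--Berge, \<open>\<mu>(H) \<ge> |U| + \<Sum>|C| div 2\<close> for some vertex set \<open>U\<close> and a
  partition of the other vertices into parts \<open>C\<close> without \<open>H\<close>-edges between them. A part is small if it is odd of size at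
  most \<open>\<beta>/8\<close>; let \<open>B\<close> be the union of the other parts, and \<open>a\<close> the sum of \<open>|C| div 2\<close> over the
  small ones. A maximum matching \<open>M\<close> of \<open>G\<close> beats \<open>\<mu>(H)\<close> only through edges that avoid \<open>U\<close> and join
  different parts. These are not in \<open>H\<close>, so the set \<open>S\<close> of their ends has \<open>H\<close>-degree sum at least
  \<open>\<beta>\<^sup>-|S|/2\<close>. On the other hand the degree bound on edges of \<open>H\<close> makes every subgraph of \<open>H\<close> on \<open>n\<close>
  vertices have at most \<open>\<beta>n/4\<close> edges, and the edges inside small parts number at most \<open>\<beta>a/8\<close>; hence
  \<open>|S| \<le> (1 + O(\<epsilon>))(|U| + a + |B|)\<close>. If only the matching edges avoiding \<open>B\<close> are used, the
  term \<open>|B|\<close> disappears, and averaging the two bounds gives the ratio 2/3.\<close>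

section \<open>Maximum matchings and a Tutte--Berge partition\<close>

lemma card_matching_le_mu:
  assumes "finite_graph K" "matching K M"
  shows "card M \<le> mu K"
  unfolding mu_def using assms finite_matchings[OF assms(1)] by (intro Max_ge) auto

lemma maximum_matching_exists:
  assumes "finite_graph K"
  obtains M where "matching K M" "card M = mu K"
proof -
  have "mu K \<in> card ` {M. matching K M}"
    unfolding mu_def using finite_matchings[OF assms] matching_empty[of K] by (intro Max_in) auto
  then show ?thesis using that by auto
qed

lemma matching_finite: "finite_graph K \<Longrightarrow> matching K M \<Longrightarrow> finite M"
  by (meson finite_edges finite_subset matching_def)

lemma matching_subset: "matching K M \<Longrightarrow> N \<subseteq> M \<Longrightarrow> matching K N"
  unfolding matching_def by blast

lemma matching_eqI: "matching K M \<Longrightarrow> e \<in> M \<Longrightarrow> f \<in> M \<Longrightarrow> x \<in> e \<Longrightarrow> x \<in> f \<Longrightarrow> e = f"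
  by (auto simp: matching_def)

lemma finite_Union_matching:
  assumes "finite_graph K" "matching K M"
  shows "finite (\<Union>M)"
  using assms by (intro finite_subset[of "\<Union>M" "verts K"]) (auto simp: finite_graph_def matching_def)

lemma card_Union_matching:
  assumes "finite_graph K" "matching K M"
  shows "card (\<Union>M) = 2 * card M"
proof -
  have *: "card e = 2" if "e \<in> M" for e
    using assms that by (auto simp: finite_graph_def matching_def)
  have "card (\<Union>M) = sum card M"
  proof (rule card_Union_disjoint)
    show "pairwise disjnt M"
      using assms by (auto simp: pairwise_def disjnt_def matching_def)
    show "finite A" if "A \<in> M" for A
      using *[OF that] card.infinite by fastforce
  qed
  also have "\<dots> = 2 * card M" using * by simp
  finally show ?thesis .
qed

lemma matching_card_le_transversal:
  assumes "matching K M" "finite X" "\<And>e. e \<in> M \<Longrightarrow> e \<inter> X \<noteq> {}"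
  shows "card M \<le> card X"
proof -
  have "\<forall>e\<in>M. \<exists>x. x \<in> e \<inter> X" using assms(3) by blast
  then obtain f where f: "\<And>e. e \<in> M \<Longrightarrow> f e \<in> e \<inter> X" by metis
  have "inj_on f M"
  proof (rule inj_onI)
    fix e e' assume "e \<in> M" "e' \<in> M" "f e = f e'"
    then show "e = e'" using f[of e] f[of e'] by (intro matching_eqI[OF assms(1), of e e' "f e"]) auto
  qed
  then show ?thesis using f assms(2) by (intro card_inj_on_le[of f]) auto
qed

text \<open>The step in the classical proof of Gallai's lemma: among the maximum matchings missing
  \<open>t\<close>, one that shares as many edges as possible with \<open>M\<close> does the job, since it could otherwise
  be exchanged along an edge of \<open>M\<close>.\<close>

lemma maximum_matching_missing_exchange:
  assumes K: "finite_graph K"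
    and M: "matching K M" "card M = mu K" "u \<notin> \<Union>M" "v \<notin> \<Union>M" "u \<noteq> v"
    and t: "\<exists>N. matching K N \<and> card N = mu K \<and> t \<notin> \<Union>N"
  shows "\<exists>N. matching K N \<and> card N = mu K \<and> t \<notin> \<Union>N \<and> (u \<notin> \<Union>N \<or> v \<notin> \<Union>N)"
proof (rule ccontr)
  assume neg: "\<not> ?thesis"
  define Q where "Q N \<longleftrightarrow> matching K N \<and> card N = mu K \<and> t \<notin> \<Union>N" for N
  have finM: "finite M" using K M matching_finite by blast
  obtain N0 where "Q N0" using t by (auto simp: Q_def)
  moreover have "\<forall>N. Q N \<longrightarrow> card (M \<inter> N) < Suc (card M)"
    using finM by (auto simp: less_Suc_eq_le intro: card_mono)
  ultimately obtain N where N: "Q N" and best: "\<And>N'. Q N' \<Longrightarrow> card (M \<inter> N') \<le> card (M \<inter> N)"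
    using ex_has_greatest_nat[of Q N0 "\<lambda>N. card (M \<inter> N)" "Suc (card M)"] by blast
  have mN: "matching K N" "card N = mu K" "t \<notin> \<Union>N" using N by (auto simp: Q_def)
  have finN: "finite N" using K mN matching_finite by blast
  \<comment> \<open>By \<open>neg\<close>, \<open>N\<close> covers \<open>u\<close> and
    \<open>v\<close>, which \<open>M\<close> misses. Matchings of equal size cover equally many
    vertices, so \<open>M\<close> covers at least two vertices missed by \<open>N\<close>, and one
    of them differs from \<open>t\<close>.\<close>
  have "{u, v} \<subseteq> \<Union>N - \<Union>M" using neg mN M by blast
  then have "card {u, v} \<le> card (\<Union>N - \<Union>M)"
    using K mN finite_Union_matching by (intro card_mono) blast+
  then have "2 \<le> card (\<Union>N - \<Union>M)" using \<open>u \<noteq> v\<close> by simp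
  moreover have "card (\<Union>N - \<Union>M) = card (\<Union>M - \<Union>N)"
  proof -
    have "card (\<Union>N) = card (\<Union>M)" using K M mN card_Union_matching by metis
    then show ?thesis
      using finite_Union_matching[OF K M(1)] finite_Union_matching[OF K mN(1)]
      by (simp add: card_Diff_subset_Int Int_commute)
  qed
  ultimately have "\<not> \<Union>M - \<Union>N \<subseteq> {t}"
    using card_mono[of "{t}" "\<Union>M - \<Union>N"] by auto
  then obtain x where x: "x \<in> \<Union>M" "x \<notin> \<Union>N" "x \<noteq> t" by blast
  then obtain e where e: "e \<in> M" "x \<in> e" by blast
  have eK: "e \<in> edges K" using e M by (auto simp: matching_def)
  then have "card e = 2" using K by (auto simp: finite_graph_def)
  then obtain y where y: "e = {x, y}" "x \<noteq> y" using e(2) by (auto simp: card_2_iff)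
  have eN: "e \<notin> N" using x e by blast
  have "y \<in> \<Union>N"
  proof (rule ccontr)
    assume "y \<notin> \<Union>N"
    then have "matching K (insert e N)"
      using mN(1) eK x y by (auto simp: matching_def)
    then have "card (insert e N) \<le> mu K" using K card_matching_le_mu by blast
    then show False using eN finN mN by simp
  qed
  then obtain f where f: "f \<in> N" "y \<in> f" by blast
  have fM: "f \<notin> M" using matching_eqI[OF M(1) e(1), of f y] f y eN by auto
  \<comment> \<open>Swapping \<open>f\<close> for \<open>e\<close> keeps the size and still misses
    \<open>t\<close>: \<open>x\<close> was chosen different from it, and \<open>y\<close> is covered
    by \<open>N\<close>. Since \<open>f\<close> is not in \<open>M\<close>, the overlap with
    \<open>M\<close> grows, against the choice of \<open>N\<close>.\<close>
  define N' where "N' = insert e (N - {f})"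
  have "y \<notin> \<Union>(N - {f})" using matching_eqI[OF mN(1) f(1)] f(2) by blast
  then have "matching K N'"
    using mN(1) eK x y by (auto simp: matching_def N'_def)
  moreover have "card N' = mu K"
    using eN finN f mN(2) by (simp add: N'_def card_Suc_Diff1 del: card_Diff_insert)
  moreover have "t \<notin> \<Union>N'" using x y mN(3) \<open>y \<in> \<Union>N\<close> by (auto simp: N'_def)
  ultimately have "card (M \<inter> N') \<le> card (M \<inter> N)" using best by (auto simp: Q_def)
  moreover have "M \<inter> N' = insert e (M \<inter> N)" using e fM by (auto simp: N'_def)
  ultimately show False using eN finM by simp
qed

text \<open>A weak form of the Tutte--Berge formula, which asks the parts to have no edges between them
  but not to be connected. If some vertex is covered by all maximum matchings, put it into \<open>U\<close> and
  recurse. Otherwise take \<open>U = {}\<close> and put two distinct vertices in the same part iff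
  no maximum matching misses both.\<close>

theorem Tutte_Berge_partition:
  assumes "finite_graph K"
  shows "\<exists>U P. U \<subseteq> verts K \<and> partition_on (verts K - U) P \<and>
    (\<forall>e\<in>edges K. e \<inter> U \<noteq> {} \<or> (\<exists>C\<in>P. e \<subseteq> C)) \<and>
    card U + (\<Sum>C\<in>P. card C div 2) \<le> mu K"
  using assms
proof (induction "card (verts K)" arbitrary: K rule: less_induct)
  case less
  note K = less.prems
  have finV: "finite (verts K)" using K by (simp add: finite_graph_def)
  define mm where "mm M \<longleftrightarrow> matching K M \<and> card M = mu K" for M
  show ?case
  proof (cases "\<exists>v\<in>verts K. \<forall>M. mm M \<longrightarrow> v \<in> \<Union>M")
    case True
    then obtain v where v: "v \<in> verts K" "\<And>M. mm M \<Longrightarrow> v \<in> \<Union>M" by blast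
    define K' where "K' = (verts K - {v}, {e \<in> edges K. v \<notin> e})"
    have vK': "verts K' = verts K - {v}" and eK': "edges K' = {e \<in> edges K. v \<notin> e}"
      by (auto simp: K'_def verts_def edges_def)
    have K': "finite_graph K'" using K by (auto simp: finite_graph_def vK' eK')
    have "card (verts K') < card (verts K)" unfolding vK' using v(1) finV by (rule card_Diff1_less[rotated])
    from less.hyps[OF this K'] obtain U P where U: "U \<subseteq> verts K'"
      and P: "partition_on (verts K' - U) P"
      and E: "\<forall>e\<in>edges K'. e \<inter> U \<noteq> {} \<or> (\<exists>C\<in>P. e \<subseteq> C)"
      and c: "card U + (\<Sum>C\<in>P. card C div 2) \<le> mu K'" by blast
    \<comment> \<open>A matching of \<open>K'\<close> misses \<open>v\<close>, so it is not maximum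
      in \<open>K\<close>. Deleting \<open>v\<close> thus lowers \<open>mu\<close> by at least one,
      which pays for adding \<open>v\<close> to \<open>U\<close>.\<close>
    obtain M where M: "matching K' M" "card M = mu K'" using maximum_matching_exists[OF K'] by blast
    then have "matching K M" "v \<notin> \<Union>M" by (auto simp: matching_def eK')
    then have "card M \<le> mu K" "card M \<noteq> mu K"
      using card_matching_le_mu[OF K] v(2)[of M] by (auto simp: mm_def)
    then have "mu K' < mu K" using M(2) by simp
    moreover have "card (insert v U) = Suc (card U)"
      using U finV finite_subset by (subst card_insert_disjoint) (auto simp: vK' intro: finite_subset)
    moreover have "verts K - insert v U = verts K' - U" by (auto simp: vK')
    ultimately show ?thesis using U P E c v(1)
      by (intro exI[of _ "insert v U"] exI[of _ P]) (auto simp: vK' eK')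
  next
    case False
    then have miss: "\<And>t. t \<in> verts K \<Longrightarrow> \<exists>N. matching K N \<and> card N = mu K \<and> t \<notin> \<Union>N"
      by (auto simp: mm_def)
    define R where
      "R = {(u, v). u \<in> verts K \<and> v \<in> verts K \<and> (u = v \<or> (\<forall>M. mm M \<longrightarrow> u \<in> \<Union>M \<or> v \<in> \<Union>M))}"
    have R: "equiv (verts K) R"
    proof (rule equivI)
      show "R \<subseteq> verts K \<times> verts K" "refl_on (verts K) R" "sym R"
        by (auto simp: R_def refl_on_def sym_def)
      \<comment> \<open>If some maximum matching missed both \<open>u\<close> and \<open>v\<close>,
        the exchange would give one that misses \<open>t\<close> and one of \<open>u\<close>,
        \<open>v\<close>, against one of the two assumed relations.\<close>
      show "trans R"
      proof (rule transI, rule ccontr)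
        fix u t v assume R: "(u, t) \<in> R" "(t, v) \<in> R" "(u, v) \<notin> R"
        then have "u \<noteq> t" "t \<noteq> v" by auto
        with R have *: "t \<in> verts K" "\<forall>M. mm M \<longrightarrow> u \<in> \<Union>M \<or> t \<in> \<Union>M"
           "\<forall>M. mm M \<longrightarrow> t \<in> \<Union>M \<or> v \<in> \<Union>M"
          unfolding R_def by blast+
        have "u \<noteq> v" "\<exists>M. mm M \<and> u \<notin> \<Union>M \<and> v \<notin> \<Union>M" using R unfolding R_def by blast+
        then obtain M where "mm M" "u \<notin> \<Union>M" "v \<notin> \<Union>M" by blast
        then obtain N where "mm N" "t \<notin> \<Union>N" "u \<notin> \<Union>N \<or> v \<notin> \<Union>N"
          using maximum_matching_missing_exchange[OF K _ _ _ _ \<open>u \<noteq> v\<close> miss[OF *(1)], of M]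
          unfolding mm_def by blast
        then show False using * by blast
      qed
    qed
    \<comment> \<open>A maximum matching missing both ends of an edge could be enlarged by it. Hence
      no edge joins two classes.\<close>
    have edgeR: "(x, y) \<in> R" if "{x, y} \<in> edges K" for x y
    proof -
      have V: "x \<in> verts K" "y \<in> verts K" using K that by (auto simp: finite_graph_def)
      have "x \<in> \<Union>M \<or> y \<in> \<Union>M" if M: "mm M" for M
      proof (rule ccontr)
        assume neg: "\<not> ?thesis"
        then have "matching K (insert {x, y} M)"
          using M \<open>{x, y} \<in> edges K\<close> by (auto simp: mm_def matching_def)
        then have "card (insert {x, y} M) \<le> card M"
          using card_matching_le_mu[OF K] M by (auto simp: mm_def)
        moreover have "{x, y} \<notin> M" "finite M"
          using neg M matching_finite[OF K] by (auto simp: mm_def)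
        ultimately show False by simp
      qed
      then show ?thesis using V by (auto simp: R_def)
    qed
    define P where "P = verts K // R"
    have P: "partition_on (verts K) P" unfolding P_def by (rule partition_on_quotient[OF R])
    have in_part: "e \<subseteq> C" if e: "e \<in> edges K" "C \<in> P" "x \<in> e" "x \<in> C" for e C x
    proof -
      have "card e = 2" using K e(1) by (auto simp: finite_graph_def)
      then obtain y where y: "e = {x, y}" using e(3) by (auto simp: card_2_iff)
      then have "(x, y) \<in> R" using edgeR e(1) by blast
      then have "y \<in> C" using e R unfolding P_def by (meson in_quotient_imp_closed)
      then show ?thesis using y e by auto
    qed
    obtain M where M: "mm M" using maximum_matching_exists[OF K] unfolding mm_def by blast
    have mM: "matching K M" "card M = mu K" using M by (auto simp: mm_def)
    define MC where "MC C = {e \<in> M. e \<subseteq> C}" for C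
    have finM: "finite M" using K mM matching_finite by blast
    have finP: "finite P" using P finV by (rule finite_elements[rotated])
    have "card C div 2 \<le> card (MC C)" if C: "C \<in> P" for C
    proof -
      have CV: "C \<subseteq> verts K" using C P by (auto simp: partition_on_def)
      have finC: "finite C" using CV finV finite_subset by blast
      have mC: "matching K (MC C)" by (rule matching_subset[OF mM(1)]) (auto simp: MC_def)
      \<comment> \<open>Every edge that meets \<open>C\<close> lies in \<open>C\<close>, so a vertex
        of \<open>C\<close> not covered by \<open>MC C\<close> is missed by all of \<open>M\<close>.
        Two distinct such vertices would contradict \<open>R\<close>; hence \<open>M\<close> misses
        at most one vertex of \<open>C\<close>.\<close>
      have eq: "x = y" if "x \<in> C - \<Union>(MC C)" "y \<in> C - \<Union>(MC C)" for x y
      proof -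
        have "M \<subseteq> edges K" using mM(1) by (simp add: matching_def)
        then have *: "z \<notin> \<Union>M" if "z \<in> C - \<Union>(MC C)" for z
          using that in_part[OF _ C] unfolding MC_def by blast
        have "x \<notin> \<Union>M" "y \<notin> \<Union>M" using *[OF that(1)] *[OF that(2)] .
        moreover have "(x, y) \<in> R" using C that quotient_eq_iff[OF R, of C C x y] by (simp add: P_def)
        ultimately show ?thesis using M unfolding R_def by blast
      qed
      have "card (C - \<Union>(MC C)) \<le> 1"
        using eq finC by (simp add: card_le_Suc0_iff_eq)
      moreover have "card (C - \<Union>(MC C)) = card C - 2 * card (MC C)"
        using card_Union_matching[OF K mC] finite_Union_matching[OF K mC]
        by (subst card_Diff_subset) (auto simp: MC_def)
      ultimately show ?thesis by linarith
    qed
    then have "(\<Sum>C\<in>P. card C div 2) \<le> (\<Sum>C\<in>P. card (MC C))" by (rule sum_mono)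
    also have "\<dots> = card (\<Union>C\<in>P. MC C)"
    proof (rule card_UN_disjoint[symmetric])
      show "\<forall>C\<in>P. finite (MC C)" using finM by (simp add: MC_def)
      show "\<forall>C\<in>P. \<forall>D\<in>P. C \<noteq> D \<longrightarrow> MC C \<inter> MC D = {}"
      proof (intro ballI impI)
        fix C D assume "C \<in> P" "D \<in> P" "C \<noteq> D"
        then have "C \<inter> D = {}" using P by (auto simp: partition_on_def disjoint_def)
        moreover have "{} \<notin> M" using mM(1) K by (force simp: matching_def finite_graph_def)
        ultimately show "MC C \<inter> MC D = {}"
          by (auto simp: MC_def) (metis Int_greatest subset_empty)
      qed
    qed (rule finP)
    also have "\<dots> \<le> card M" using finM by (intro card_mono) (auto simp: MC_def)
    finally have "(\<Sum>C\<in>P. card C div 2) \<le> mu K" using mM by simp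
    moreover have "\<exists>C\<in>P. e \<subseteq> C" if "e \<in> edges K" for e
    proof -
      have "e \<subseteq> verts K" "e \<noteq> {}" using K that by (auto simp: finite_graph_def)
      then obtain x where "x \<in> e" "x \<in> \<Union>P" using P unfolding partition_on_def by blast
      then show ?thesis using in_part that by blast
    qed
    ultimately show ?thesis using P by (intro exI[of _ "{}"] exI[of _ P]) auto
  qed
qed

section \<open>Edge counts and degree sums\<close>

lemma sum_card_incident:
  assumes "finite S" "finite F"
  shows "(\<Sum>v\<in>S. card {e \<in> F. v \<in> e}) = (\<Sum>e\<in>F. card (e \<inter> S))"
proof -
  have "(\<Sum>v\<in>S. card {e \<in> F. v \<in> e}) = (\<Sum>v\<in>S. \<Sum>e\<in>F. if v \<in> e then 1 else 0)"
    using assms by (simp add: sum.If_cases Int_def)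
  also have "\<dots> = (\<Sum>e\<in>F. \<Sum>v\<in>S. if v \<in> e then 1 else 0)" by (rule sum.swap)
  also have "\<dots> = (\<Sum>e\<in>F. card (e \<inter> S))"
    using assms by (simp add: sum.If_cases Int_def conj_commute)
  finally show ?thesis .
qed

text \<open>With \<open>d\<close> the degree in \<open>F\<close>, the sum of \<open>d\<close> over
  \<open>W\<close> is \<open>2|F|\<close>. The sum of the squares equals the sum of
  \<open>d u + d v\<close> over the edges, hence is at most \<open>\<beta>|F|\<close>. Expanding the
  nonnegative sum of \<open>(d v - \<beta>/2)^2\<close> gives the bound.\<close>

lemma card_edges_le_of_degree_sum:
  fixes \<beta> :: real
  assumes H: "finite_graph H" and "\<beta> > 0"
    and deg: "\<And>u v. {u, v} \<in> edges H \<Longrightarrow> real (deg H u) + real (deg H v) \<le> \<beta>"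
    and F: "F \<subseteq> edges H" "\<Union>F \<subseteq> W" "finite W"
  shows "4 * real (card F) \<le> \<beta> * real (card W)"
proof -
  define d where "d v = card {e \<in> F. v \<in> e}" for v
  have finF: "finite F" using H F finite_edges finite_subset by blast
  have d_le: "d v \<le> deg H v" for v
    unfolding d_def deg_def using F finite_edges[OF H] by (intro card_mono) auto
  have two: "card e = 2" "e \<inter> W = e" if "e \<in> F" for e
    using H F that by (auto simp: finite_graph_def)
  have "(\<Sum>v\<in>W. d v) = 2 * card F"
    unfolding d_def using sum_card_incident[OF F(3) finF] two by simp
  then have sum1: "(\<Sum>v\<in>W. real (d v)) = 2 * real (card F)"
    by (simp flip: of_nat_sum)
  have "(\<Sum>v\<in>W. (real (d v))\<^sup>2) = (\<Sum>v\<in>W. \<Sum>e\<in>F. if v \<in> e then real (d v) else 0)"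
    using finF by (simp add: sum.If_cases Int_def d_def power2_eq_square)
  also have "\<dots> = (\<Sum>e\<in>F. \<Sum>v\<in>W. if v \<in> e then real (d v) else 0)" by (rule sum.swap)
  also have "\<dots> = (\<Sum>e\<in>F. \<Sum>v\<in>e. real (d v))"
  proof (rule sum.cong)
    fix e assume "e \<in> F"
    then have "{v \<in> W. v \<in> e} = e" using two by blast
    then show "(\<Sum>v\<in>W. if v \<in> e then real (d v) else 0) = (\<Sum>v\<in>e. real (d v))"
      using F(3) by (simp add: sum.If_cases Int_def)
  qed simp
  also have "\<dots> \<le> (\<Sum>e\<in>F. \<beta>)"
  proof (rule sum_mono)
    fix e assume e: "e \<in> F"
    then obtain u v where "e = {u, v}" "u \<noteq> v" using two(1)[OF e] by (auto simp: card_2_iff)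
    then show "(\<Sum>v\<in>e. real (d v)) \<le> \<beta>"
      using deg[of u v] d_le[of u] d_le[of v] e F by auto
  qed
  finally have sum2: "(\<Sum>v\<in>W. (real (d v))\<^sup>2) \<le> \<beta> * real (card F)" by (simp add: mult.commute)
  have "0 \<le> (\<Sum>v\<in>W. (real (d v) - \<beta> / 2)\<^sup>2)" by (intro sum_nonneg) auto
  also have "\<dots> = (\<Sum>v\<in>W. (real (d v))\<^sup>2) - \<beta> * (\<Sum>v\<in>W. real (d v)) + \<beta>\<^sup>2 / 4 * real (card W)"
    by (simp add: power2_diff sum.distrib sum_subtractf sum_distrib_left power_divide mult.commute)
  finally have "0 \<le> \<beta> * (\<beta> * real (card W) - 4 * real (card F))"
    using sum1 sum2 by (simp add: algebra_simps power2_eq_square)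
  then show ?thesis using \<open>\<beta> > 0\<close> by (simp add: zero_le_mult_iff)
qed

text \<open>An edge counts once for each of its ends in \<open>S\<close>. Outside \<open>I\<close>,
  the edges meeting \<open>S\<close> (\<open>F\<close>) live on \<open>S \<union> T\<close>, and
  those counted a second time (\<open>F2\<close>) live on \<open>S \<inter> T\<close>. The edge
  bound applies to each family, and the sizes of union and intersection add up to
  \<open>|S| + |T|\<close>.\<close>

lemma sum_deg_le:
  fixes \<beta> :: real
  assumes H: "finite_graph H" and "\<beta> > 0"
    and deg: "\<And>u v. {u, v} \<in> edges H \<Longrightarrow> real (deg H u) + real (deg H v) \<le> \<beta>"
    and fin: "finite S" "finite T" and I: "I \<subseteq> edges H"
    and touch: "\<And>e. e \<in> edges H - I \<Longrightarrow> e \<inter> S \<noteq> {} \<Longrightarrow> e \<subseteq> S \<union> T"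
    and inside: "\<And>e. e \<in> edges H - I \<Longrightarrow> e \<subseteq> S \<Longrightarrow> e \<subseteq> T"
  shows "4 * (\<Sum>v\<in>S. real (deg H v)) \<le> 8 * real (card I) + \<beta> * (real (card S) + real (card T))"
proof -
  define F where "F = {e \<in> edges H - I. e \<inter> S \<noteq> {}}"
  define F2 where "F2 = {e \<in> edges H - I. e \<subseteq> S}"
  have finE: "finite (edges H)" using H finite_edges by blast
  have fins: "finite F" "finite F2" "finite I"
    using finE I by (auto simp: F_def F2_def intro: finite_subset)
  have two: "card e = 2" if "e \<in> edges H" for e using H that by (auto simp: finite_graph_def)
  have finite_edge: "finite e" if "e \<in> edges H" for e using two[OF that] card.infinite by fastforce
  have F2F: "F2 \<subseteq> F" using two by (force simp: F_def F2_def Int_absorb2)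
  have "(\<Sum>v\<in>S. deg H v) = (\<Sum>e\<in>edges H. card (e \<inter> S))"
    unfolding deg_def by (rule sum_card_incident[OF fin(1) finE])
  also have "\<dots> = (\<Sum>e\<in>I. card (e \<inter> S)) + (\<Sum>e\<in>edges H - I. card (e \<inter> S))"
    using finE I by (simp add: sum.subset_diff add.commute)
  also have "(\<Sum>e\<in>edges H - I. card (e \<inter> S)) = (\<Sum>e\<in>F. card (e \<inter> S))"
    using finE by (intro sum.mono_neutral_right) (auto simp: F_def)
  also have "\<dots> \<le> (\<Sum>e\<in>F. 1 + (if e \<in> F2 then 1 else 0))"
  proof (rule sum_mono)
    fix e assume e: "e \<in> F"
    then have eH: "e \<in> edges H" by (simp add: F_def)
    have "card (e \<inter> S) < card e" if "e \<notin> F2"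
      using e that finite_edge[OF eH] by (intro psubset_card_mono) (auto simp: F_def F2_def)
    moreover have "card (e \<inter> S) \<le> card e" using finite_edge[OF eH] by (intro card_mono) auto
    ultimately show "card (e \<inter> S) \<le> 1 + (if e \<in> F2 then 1 else 0)" using two[OF eH] by auto
  qed
  also have "\<dots> = card F + card F2"
    using fins F2F by (simp add: sum.distrib sum.If_cases Int_absorb1 del: One_nat_def plus_1_eq_Suc)
  also have "(\<Sum>e\<in>I. card (e \<inter> S)) \<le> (\<Sum>e\<in>I. 2)"
    using two I finite_edge by (intro sum_mono) (metis Int_lower1 card_mono subsetD)
  finally have "(\<Sum>v\<in>S. deg H v) \<le> 2 * card I + (card F + card F2)" by simp
  then have "(\<Sum>v\<in>S. real (deg H v)) \<le> 2 * real (card I) + (real (card F) + real (card F2))"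
    by (simp flip: of_nat_sum)
  moreover have "4 * real (card F) \<le> \<beta> * real (card (S \<union> T))"
    using fin touch by (intro card_edges_le_of_degree_sum[OF H \<open>\<beta> > 0\<close> deg]) (auto simp: F_def)
  moreover have "4 * real (card F2) \<le> \<beta> * real (card (S \<inter> T))"
    using fin inside by (intro card_edges_le_of_degree_sum[OF H \<open>\<beta> > 0\<close> deg]) (auto simp: F2_def)
  moreover have "real (card S) + real (card T) = real (card (S \<union> T)) + real (card (S \<inter> T))"
    using card_Un_Int[OF fin] by linarith
  ultimately show ?thesis by (simp add: distrib_left)
qed

text \<open>A part of odd size \<open>2m + 1\<close> contains \<open>(2m + 1)m\<close> pairs, and
  \<open>8(2m + 1) \<le> \<beta>\<close> turns eight times this number into at most
  \<open>\<beta>m\<close>, where \<open>m\<close> is its contribution to the sum.\<close>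

lemma card_edges_within_small_parts:
  fixes \<beta> :: real
  assumes "finite Q" and Q: "\<And>C. C \<in> Q \<Longrightarrow> finite C \<and> odd (card C) \<and> 8 * real (card C) \<le> \<beta>"
    and I: "\<And>e. e \<in> I \<Longrightarrow> card e = 2 \<and> (\<exists>C\<in>Q. e \<subseteq> C)"
  shows "8 * real (card I) \<le> \<beta> * real (\<Sum>C\<in>Q. card C div 2)"
proof -
  define D where "D C = {e. e \<subseteq> C \<and> card e = 2}" for C :: "'a set"
  have finD: "finite (D C)" if "C \<in> Q" for C
    using Q[OF that] by (auto simp: D_def intro: finite_subset[of _ "Pow C"])
  have "card I \<le> card (\<Union>C\<in>Q. D C)"
    using I finD \<open>finite Q\<close> by (intro card_mono) (auto simp: D_def)
  also have "\<dots> \<le> (\<Sum>C\<in>Q. card (D C))" by (rule card_UN_le[OF \<open>finite Q\<close>])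
  finally have "8 * real (card I) \<le> (\<Sum>C\<in>Q. 8 * real (card (D C)))"
    by (simp flip: sum_distrib_left of_nat_sum)
  also have "\<dots> \<le> (\<Sum>C\<in>Q. \<beta> * real (card C div 2))"
  proof (rule sum_mono)
    fix C assume C: "C \<in> Q"
    obtain m where m: "card C = 2 * m + 1" using Q[OF C] by (auto elim: oddE)
    have "card (D C) = card C choose 2" unfolding D_def using Q[OF C] by (intro n_subsets) auto
    also have "\<dots> = card C * m" unfolding choose_two m by simp
    finally have "8 * real (card (D C)) = (8 * real (card C)) * real m" by simp
    also have "\<dots> \<le> \<beta> * real m" using Q[OF C] by (intro mult_right_mono) auto
    also have "real m = real (card C div 2)" using m by simp
    finally show "8 * real (card (D C)) \<le> \<beta> * real (card C div 2)" .
  qed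
  finally show ?thesis by (simp add: sum_distrib_left)
qed

section \<open>Bounds for matchings, and the closing arithmetic\<close>

lemma sum_over_Union_matching_ge:
  fixes g :: "'a \<Rightarrow> real"
  assumes G: "finite_graph G" and N: "matching G N"
    and g: "\<And>u v. {u, v} \<in> N \<Longrightarrow> c \<le> g u + g v"
  shows "c * real (card N) \<le> (\<Sum>v\<in>\<Union>N. g v)"
proof -
  have two: "card e = 2" if "e \<in> N" for e
    using G N that by (auto simp: finite_graph_def matching_def)
  have "(\<Sum>v\<in>\<Union>N. g v) = (\<Sum>e\<in>N. \<Sum>v\<in>e. g v)"
  proof (subst sum.Union_disjoint)
    show "\<forall>e\<in>N. finite e" using two by (metis card.infinite zero_neq_numeral)
    show "\<forall>e\<in>N. \<forall>f\<in>N. e \<noteq> f \<longrightarrow> e \<inter> f = {}" using N by (simp add: matching_def)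
  qed simp
  moreover have "(\<Sum>e\<in>N. c) \<le> (\<Sum>e\<in>N. \<Sum>v\<in>e. g v)"
  proof (rule sum_mono)
    fix e assume e: "e \<in> N"
    then obtain u v where "e = {u, v}" "u \<noteq> v" using two[OF e] by (auto simp: card_2_iff)
    then show "c \<le> (\<Sum>v\<in>e. g v)" using g[of u v] e by auto
  qed
  ultimately show ?thesis by (simp add: mult.commute)
qed

lemma card_matching_within_parts:
  assumes G: "finite_graph G" and M: "matching G M"
    and Q: "finite Q" "\<And>C. C \<in> Q \<Longrightarrow> finite C" and sub: "\<And>e. e \<in> M \<Longrightarrow> \<exists>C\<in>Q. e \<subseteq> C"
  shows "card M \<le> (\<Sum>C\<in>Q. card C div 2)"
proof -
  define MC where "MC C = {e \<in> M. e \<subseteq> C}" for C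
  have finM: "finite M" using G M matching_finite by blast
  have "card M \<le> card (\<Union>C\<in>Q. MC C)"
    using sub finM Q by (intro card_mono) (auto simp: MC_def)
  also have "\<dots> \<le> (\<Sum>C\<in>Q. card (MC C))" by (rule card_UN_le[OF Q(1)])
  also have "\<dots> \<le> (\<Sum>C\<in>Q. card C div 2)"
  proof (rule sum_mono)
    fix C assume C: "C \<in> Q"
    have "matching G (MC C)" by (rule matching_subset[OF M]) (auto simp: MC_def)
    then have "2 * card (MC C) = card (\<Union>(MC C))" using card_Union_matching[OF G] by simp
    also have "\<dots> \<le> card C" using Q(2)[OF C] by (intro card_mono) (auto simp: MC_def)
    finally show "card (MC C) \<le> card C div 2" by simp
  qed
  finally show ?thesis .
qed

text \<open>Here \<open>p\<close> stands for \<open>|U| + a\<close>, \<open>b\<close> for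
  \<open>|B|\<close>, \<open>g\<close> and \<open>h\<close> for the matching numbers of
  \<open>G\<close> and \<open>H\<close>, and \<open>t\<close> for the weighted number of matching
  edges between parts. In terms of \<open>q = p + b/2\<close>, \<open>g\<close> is at most about
  \<open>3q/2\<close> and \<open>h\<close> at least about \<open>q\<close>. Only
  \<open>\<epsilon> \<le> 2/3\<close> needs an estimate, as otherwise the left side is not
  positive.\<close>

lemma two_thirds_bound:
  fixes \<epsilon> :: real
  assumes \<epsilon>: "0 < \<epsilon>" "\<epsilon> \<le> 1" and nn: "0 \<le> p" "0 \<le> b" "0 \<le> g" "0 \<le> h"
    and g: "2 * g \<le> 2 * p + b + t"
    and t: "(1 - \<epsilon> / 5) * t \<le> p + b / 2"
    and c: "(1 - 4 * \<epsilon> / 25) * (b / 2) \<le> c"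
    and h: "p + c \<le> h"
  shows "(2 / 3 - \<epsilon>) * g \<le> h"
proof (cases "\<epsilon> \<le> 2 / 3")
  case True
  define q where "q = p + b / 2"
  have q: "0 \<le> q" using nn by (simp add: q_def)
  \<comment> \<open>The factor \<open>1 + \<epsilon>/4\<close> is a linear upper bound for the
    inverse of \<open>1 - \<epsilon>/5\<close>, valid for \<open>\<epsilon> \<le> 1\<close>.\<close>
  have "1 \<le> (1 - \<epsilon> / 5) * (1 + \<epsilon> / 4)" using \<epsilon> by (simp add: algebra_simps)
  then have "(1 - \<epsilon> / 5) * t \<le> (1 - \<epsilon> / 5) * (1 + \<epsilon> / 4) * q"
    using t q mult_right_mono[of 1 "(1 - \<epsilon> / 5) * (1 + \<epsilon> / 4)" q] by (simp add: q_def)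
  then have "t \<le> (1 + \<epsilon> / 4) * q" using \<epsilon> by (simp add: mult.assoc)
  then have "g \<le> (3 / 2 + \<epsilon> / 8) * q" using g by (simp add: q_def field_simps)
  then have "(2 / 3 - \<epsilon>) * g \<le> (2 / 3 - \<epsilon>) * ((3 / 2 + \<epsilon> / 8) * q)"
    using True by (intro mult_left_mono) auto
  also have "\<dots> = ((2 / 3 - \<epsilon>) * (3 / 2 + \<epsilon> / 8)) * q" by simp
  also have "\<dots> \<le> (1 - 4 * \<epsilon> / 25) * q"
  proof (rule mult_right_mono[OF _ q])
    have "0 \<le> \<epsilon> * \<epsilon>" by simp
    then show "(2 / 3 - \<epsilon>) * (3 / 2 + \<epsilon> / 8) \<le> 1 - 4 * \<epsilon> / 25"
      using \<epsilon> by (simp add: algebra_simps)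
  qed
  also have "\<dots> \<le> p + c"
  proof -
    have "0 \<le> \<epsilon> * p" using \<epsilon> nn by simp
    then show ?thesis using c by (simp add: q_def field_simps)
  qed
  finally show ?thesis using h by simp
next
  case False
  then have "(2 / 3 - \<epsilon>) * g \<le> 0" using nn by (intro mult_nonpos_nonneg) auto
  then show ?thesis using nn by simp
qed

theorem theorem1p1:
  fixes \<epsilon> :: real and \<beta> \<beta>m :: int and G H :: "'a ugraph"
  assumes "0 < \<epsilon>" and "\<epsilon> \<le> 1"
    and "\<beta> > \<beta>m" and "\<beta>m \<ge> 1"
    and "real_of_int \<beta> \<ge> 50 / \<epsilon>"
    and "real_of_int \<beta>m \<ge> (1 - \<epsilon> / 10) * real_of_int \<beta>"
    and "finite_graph G"
    and "EDCS \<beta> \<beta>m G H"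
  shows "real (mu H) \<ge> (2 / 3 - \<epsilon>) * real (mu G)"
proof -
  note G = \<open>finite_graph G\<close>
  define b where "b = real_of_int \<beta>"
  have sub: "spanning_subgraph H G"
    and P1: "\<And>u v. {u, v} \<in> edges H \<Longrightarrow> int (deg H u) + int (deg H v) \<le> \<beta>"
    and P2: "\<And>u v. {u, v} \<in> edges G - edges H \<Longrightarrow> \<beta>m \<le> int (deg H u) + int (deg H v)"
    using assms(8) by (auto simp: EDCS_def)
  have H: "finite_graph H" using G sub finite_graph_spanning_subgraph by blast
  \<comment> \<open>The second fact is \<open>\<beta> \<ge> 50/\<epsilon>\<close> in the form needed
    for rounding losses in odd parts larger than \<open>\<beta>/8\<close>.\<close>
  have b: "b > 0" "8 \<le> 4 * \<epsilon> / 25 * b" using assms by (auto simp: b_def field_simps)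
  have deg_le: "real (deg H u) + real (deg H v) \<le> b" if "{u, v} \<in> edges H" for u v
    using P1[OF that] unfolding b_def by linarith
  have deg_ge: "(1 - \<epsilon> / 10) * b \<le> real (deg H u) + real (deg H v)"
    if "{u, v} \<in> edges G - edges H" for u v
    using P2[OF that] assms(6) unfolding b_def by linarith

  \<comment> \<open>Small parts and the remaining ones\<close>
  obtain U P where U: "U \<subseteq> verts H" and P: "partition_on (verts H - U) P"
    and "\<forall>e\<in>edges H. e \<inter> U \<noteq> {} \<or> (\<exists>C\<in>P. e \<subseteq> C)"
    and muH: "card U + (\<Sum>C\<in>P. card C div 2) \<le> mu H"
    using Tutte_Berge_partition[OF H] by blast
  then have E: "e \<inter> U \<noteq> {} \<or> (\<exists>C\<in>P. e \<subseteq> C)" if "e \<in> edges H" for e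
    using that by blast
  have finV: "finite (verts H)" using H by (simp add: finite_graph_def)
  have finU: "finite U" using U finV finite_subset by blast
  have finP: "finite P" using P finV by (intro finite_elements[of "verts H - U"]) auto
  have UnP: "\<Union>P = verts H - U" using P by (simp add: partition_on_def)
  have disjP: "C = D" if "C \<in> P" "D \<in> P" "x \<in> C" "x \<in> D" for C D x
    using P that by (auto simp: partition_on_def disjoint_def)
  have finC: "finite C" if "C \<in> P" for C
    using that UnP finV by (metis Union_upper finite_Diff finite_subset)
  define Q where "Q = {C \<in> P. odd (card C) \<and> 8 * real (card C) \<le> b}"
  define L where "L = P - Q"
  define B where "B = \<Union>L"
  define a where "a = (\<Sum>C\<in>Q. card C div 2)"
  define c where "c = (\<Sum>C\<in>L. card C div 2)"
  have finQ: "finite Q" and finL: "finite L" and QP: "Q \<subseteq> P" and LP: "L \<subseteq> P"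
    using finP by (auto simp: Q_def L_def)
  have finB: "finite B" using finL LP finC by (auto simp: B_def)
  have ac: "(\<Sum>C\<in>P. card C div 2) = a + c"
    unfolding a_def c_def L_def using sum.subset_diff[OF QP finP] by (simp add: add.commute)
  \<comment> \<open>Halving an even part loses nothing. An odd part in \<open>L\<close> has more
    than \<open>b/8\<close> vertices, so the lost \<open>1/2\<close> is at most the fraction
    \<open>4\<epsilon>/25\<close> of \<open>|C|/2\<close>.\<close>
  have c_ge: "(1 - 4 * \<epsilon> / 25) * (real (card B) / 2) \<le> real c"
  proof -
    have "card B = (\<Sum>C\<in>L. card C)" unfolding B_def
      using LP disjP finC by (intro card_Union_disjoint) (auto simp: pairwise_def disjnt_def; blast)+
    then have "(1 - 4 * \<epsilon> / 25) * (real (card B) / 2)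
        = (\<Sum>C\<in>L. (1 - 4 * \<epsilon> / 25) * (real (card C) / 2))"
      by (simp add: sum_distrib_left sum_divide_distrib)
    also have "\<dots> \<le> (\<Sum>C\<in>L. real (card C div 2))"
    proof (rule sum_mono)
      fix C assume C: "C \<in> L"
      have nn: "0 \<le> 4 * \<epsilon> / 25 * real (card C)" using assms(1) by simp
      show "(1 - 4 * \<epsilon> / 25) * (real (card C) / 2) \<le> real (card C div 2)"
      proof (cases "odd (card C)")
        case True
        then have "b < 8 * real (card C)" using C by (auto simp: Q_def L_def)
        then have "4 * \<epsilon> / 25 * b \<le> 4 * \<epsilon> / 25 * (8 * real (card C))"
          using assms(1) by (intro mult_left_mono) auto
        then have "1 \<le> 4 * \<epsilon> / 25 * real (card C)" using b by simp
        moreover have "real (card C div 2) = (real (card C) - 1) / 2"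
          using True by (auto elim: oddE)
        ultimately show ?thesis by (simp add: algebra_simps)
      next
        case False
        then have "real (card C div 2) = real (card C) / 2" by (auto elim: evenE)
        then show ?thesis using nn by (simp add: algebra_simps)
      qed
    qed
    finally show ?thesis by (simp add: c_def)
  qed

  \<comment> \<open>Degree count for matching edges outside \<open>H\<close>\<close>
  define I where "I = {e \<in> edges H. \<exists>C\<in>Q. e \<subseteq> C}"
  have I: "8 * real (card I) \<le> b * real a"
    unfolding a_def
  proof (rule card_edges_within_small_parts[OF finQ])
    show "finite C \<and> odd (card C) \<and> 8 * real (card C) \<le> b" if "C \<in> Q" for C
      using that finC by (auto simp: Q_def)
    show "card e = 2 \<and> (\<exists>C\<in>Q. e \<subseteq> C)" if "e \<in> I" for e
      using that H by (auto simp: I_def finite_graph_def)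
  qed
  have edge_cases: "e \<inter> U \<noteq> {} \<or> e \<subseteq> B" if "e \<in> edges H - I" for e
    using E[of e] that by (auto simp: I_def L_def B_def)
  \<comment> \<open>The degree sum over the ends of \<open>N\<close> is bounded below by (P2) and
    above by \<open>sum_deg_le\<close>. The set \<open>T\<close> has to hold the ends outside
    \<open>S\<close> of edges leaving \<open>S\<close>: these lie in \<open>U\<close>, or in
    \<open>B\<close> if \<open>S\<close> meets \<open>B\<close>.\<close>
  have key: "2 * (1 - \<epsilon> / 5) * real (card N) \<le> real a + real (card T)"
    if N: "matching G N" "N \<subseteq> edges G - edges H" "\<Union>N \<inter> U = {}"
      and T: "finite T" "U \<subseteq> T" "\<Union>N \<inter> B = {} \<or> B \<subseteq> T" for N T
  proof -
    define S where "S = \<Union>N"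
    have finS: "finite S" unfolding S_def using finite_Union_matching[OF G N(1)] .
    have cS: "real (card S) = 2 * real (card N)"
      unfolding S_def using card_Union_matching[OF G N(1)] by simp
    have "e \<subseteq> S \<union> T" if e: "e \<in> edges H - I" "e \<inter> S \<noteq> {}" for e
    proof (cases "e \<inter> U = {}")
      case True
      then have "e \<subseteq> B" using edge_cases that by blast
      then show ?thesis using T(3) that(2) by (auto simp: S_def)
    next
      case False
      then obtain x y where "x \<in> e" "x \<in> U" "y \<in> e" "y \<in> S" using e by blast
      moreover have "x \<noteq> y" using calculation N(3) by (auto simp: S_def)
      moreover have "card e = 2" using H that by (auto simp: finite_graph_def)
      ultimately have "e = {x, y}" by (auto simp: card_2_iff)
      then show ?thesis using \<open>x \<in> U\<close> \<open>y \<in> S\<close> T(2) by auto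
    qed
    \<comment> \<open>Such an edge avoids \<open>U\<close>, so it lies in \<open>B\<close>; then
      \<open>S\<close> meets \<open>B\<close>, which forces \<open>B \<subseteq> T\<close>.\<close>
    moreover have "e \<subseteq> T" if "e \<in> edges H - I" "e \<subseteq> S" for e
    proof -
      have "e \<subseteq> B" using edge_cases[OF that(1)] that(2) N(3) by (auto simp: S_def)
      moreover have "e \<noteq> {}" using H that(1) by (auto simp: finite_graph_def)
      ultimately show ?thesis using T(3) that(2) by (auto simp: S_def)
    qed
    ultimately have "4 * (\<Sum>v\<in>S. real (deg H v))
        \<le> 8 * real (card I) + b * (real (card S) + real (card T))"
      using finS T(1) by (intro sum_deg_le[OF H b(1) deg_le]) (auto simp: I_def)
    moreover have "(1 - \<epsilon> / 10) * b * real (card N) \<le> (\<Sum>v\<in>S. real (deg H v))"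
      unfolding S_def using N(2) deg_ge by (intro sum_over_Union_matching_ge[OF G N(1)]) blast
    ultimately have "4 * ((1 - \<epsilon> / 10) * b * real (card N))
        \<le> b * real a + b * (2 * real (card N) + real (card T))"
      using I cS by simp
    \<comment> \<open>The factor on the left is \<open>4(1 - \<epsilon>/10) - 2\<close>.\<close>
    then have "b * (2 * (1 - \<epsilon> / 5) * real (card N)) \<le> b * (real a + real (card T))"
      by (simp add: algebra_simps)
    then show ?thesis using b by simp
  qed

  \<comment> \<open>Splitting a maximum matching of \<open>G\<close>\<close>
  obtain M where M: "matching G M" "card M = mu G" using maximum_matching_exists[OF G] by blast
  have finM: "finite M" using matching_finite[OF G M(1)] .
  have MG: "M \<subseteq> edges G" using M by (simp add: matching_def)
  define MU where "MU = {e \<in> M. e \<inter> U \<noteq> {}}"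
  define MQ where "MQ = {e \<in> M. \<exists>C\<in>Q. e \<subseteq> C}"
  define MB where "MB = {e \<in> M. \<exists>C\<in>L. e \<subseteq> C}"
  \<comment> \<open>What remains in \<open>N\<close> avoids \<open>U\<close> and lies in no single
    part, so it has no edge of \<open>H\<close>. The split into \<open>N1\<close> and
    \<open>N2\<close> serves to apply \<open>key\<close> once without \<open>B\<close> and once with
    it.\<close>
  define N where "N = M - MU - MQ - MB"
  define N1 where "N1 = {e \<in> N. e \<inter> B = {}}"
  define N2 where "N2 = {e \<in> N. e \<inter> B \<noteq> {}}"
  have m: "matching G MU" "matching G MQ" "matching G MB" "matching G N" "matching G N1" "matching G N2"
    by (rule matching_subset[OF M(1)]; auto simp: MU_def MQ_def MB_def N_def N1_def N2_def)+
  have "card M = card (MU \<union> MQ \<union> MB \<union> N)"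
    by (rule arg_cong[of _ _ card]) (auto simp: MU_def MQ_def MB_def N_def)
  then have "card M \<le> card MU + card MQ + card MB + card N"
    using card_Un_le[of "MU \<union> MQ \<union> MB" N] card_Un_le[of "MU \<union> MQ" MB] card_Un_le[of MU MQ]
    by linarith
  moreover have "card N = card N1 + card N2"
  proof -
    have "N = N1 \<union> N2" "N1 \<inter> N2 = {}" "finite N" using finM by (auto simp: N1_def N2_def N_def)
    then show ?thesis using card_Un_disjoint[of N1 N2] by simp
  qed
  moreover have "card MU \<le> card U"
    using m(1) finU by (rule matching_card_le_transversal) (auto simp: MU_def)
  moreover have "card MQ \<le> a" unfolding a_def
    using m(2) finQ QP finC by (intro card_matching_within_parts[OF G]) (auto simp: MQ_def)
  \<comment> \<open>Each edge of \<open>MB\<close> uses two vertices of \<open>B\<close>, and each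
    edge of \<open>N2\<close> at least one further vertex of \<open>B\<close>.\<close>
  moreover have "2 * card MB + card N2 \<le> card B"
  proof -
    have ss: "\<Union>MB \<subseteq> B" by (auto simp: MB_def B_def)
    have "card N2 \<le> card (B - \<Union>MB)"
    proof (rule matching_card_le_transversal[OF m(6)])
      fix e assume e: "e \<in> N2"
      have "e \<inter> \<Union>MB = {}"
        using e matching_eqI[OF M(1), of e] by (auto simp: N2_def N_def MB_def)
      then show "e \<inter> (B - \<Union>MB) \<noteq> {}" using e by (auto simp: N2_def)
    qed (use finB in auto)
    moreover have "card (B - \<Union>MB) = card B - 2 * card MB"
      using ss finite_Union_matching[OF G m(3)] card_Union_matching[OF G m(3)]
      by (simp add: card_Diff_subset)
    moreover have "2 * card MB \<le> card B"
      using card_mono[OF finB ss] card_Union_matching[OF G m(3)] by simp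
    ultimately show ?thesis by linarith
  qed
  ultimately have "2 * mu G \<le> 2 * (card U + a) + card B + (2 * card N1 + card N2)"
    unfolding M(2) by simp
  then have mG: "2 * real (mu G) \<le> 2 * (real (card U) + real a) + real (card B)
      + (2 * real (card N1) + real (card N2))"
    using of_nat_mono[where 'a = real] by fastforce
  have NG: "N \<subseteq> edges G - edges H"
  proof
    fix e assume e: "e \<in> N"
    then have "e \<inter> U = {}" "\<not> (\<exists>C\<in>P. e \<subseteq> C)"
      unfolding N_def MU_def MQ_def MB_def L_def by blast+
    then have "e \<notin> edges H" using E by blast
    then show "e \<in> edges G - edges H" using e MG by (auto simp: N_def)
  qed
  have NU: "\<Union>N \<inter> U = {}" by (auto simp: N_def MU_def)
  have k1: "2 * (1 - \<epsilon> / 5) * real (card N1) \<le> real a + real (card U)"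
    using NG NU finU by (intro key[OF m(5)]) (auto simp: N1_def)
  have "2 * (1 - \<epsilon> / 5) * real (card N) \<le> real a + real (card (U \<union> B))"
    using NG NU finU finB by (intro key[OF m(4)]) auto
  then have k2: "2 * (1 - \<epsilon> / 5) * real (card N) \<le> real a + (real (card U) + real (card B))"
    using card_Un_le[of U B] by linarith
  \<comment> \<open>This is the average of \<open>k1\<close> and \<open>k2\<close>: edges of
    \<open>N1\<close> occur in both bounds and edges of \<open>N2\<close> only in the second, which
    matches their weights in \<open>mG\<close>.\<close>
  have "(1 - \<epsilon> / 5) * (2 * real (card N1) + real (card N2))
      \<le> (real (card U) + real a) + real (card B) / 2"
    using k1 k2 \<open>card N = card N1 + card N2\<close> by (simp add: field_simps)
  moreover have "(real (card U) + real a) + real c \<le> real (mu H)"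
    using muH ac by linarith
  ultimately show ?thesis
    using two_thirds_bound[OF assms(1,2) _ _ _ _ mG _ c_ge] by simp
qed

end
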